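(* Let $n\ge1$ and let $a,b,c,d$ be linearly independent elements of $\pm\mathcal E_{n-1}'$. (1) Let $x\in\{(a,b),(b,\gamma_n a),(\tilde a,\tilde b),(\tilde b,\gamma_n\tilde a)\}$ and $y\in\{(c,d),(d,\gamma_n c),(\tilde c,\tilde d),(\tilde d,\gamma_n\tilde c)\}$. Then $x$ and $y$ are orthogonal in $\mathcal A_{n+1}$ if and only if $(a,b)$ and $(c,d)$ are orthogonal in $\mathcal A_n^{\circ}$. (2) Let $x\in\{(a,\tilde b),(\tilde b,\gamma_n a),(\tilde a,\gamma_{n-1}b),(b,\gamma_{n-1}\gamma_n\tilde a)\}$ and $y\in\{(c,\tilde d),(\tilde d,\gamma_n c),(\tilde c,\gamma_{n-1}d),(d,\gamma_{n-1}\gamma_n\tilde c)\}$. Then $x$ and $y$ are orthogonal in $\mathcal A_{n+1}$ if and only if $(a,b)$ and $(c,d)$ are orthogonal in $\mathcal A_n^{\bullet}$.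
   Context: Real Cayley–Dickson algebras: $\mathcal A_0=\mathbb R$ with trivial involution. Given parameters $\gamma_0,\gamma_1,\dots\in\{\pm1\}$ (the paper's normalization of nonzero real parameters), $\mathcal A_{k+1}=\mathcal A_{k+1}\{\gamma_0,\dots,\gamma_k\}$ is $\mathcal A_k\times\mathcal A_k$ with componentwise addition and real scaling, product $(a,b)(c,d)=(ac+\gamma_k\bar d b,\ da+b\bar c)$ and involution $\overline{(a,b)}=(\bar a,-b)$. $\mathcal A_n^{\circ}=\mathcal A_n\{\gamma_0,\dots,\gamma_{n-2},\gamma_n\}$ and $\mathcal A_n^{\bullet}=\mathcal A_n\{\gamma_0,\dots,\gamma_{n-2},\gamma_{n-1}\gamma_n\}$; both consist of pairs of elements of $\mathcal A_{n-1}$. $\mathcal A_{n-1}$ is regarded as a subalgebra of $\mathcal A_n$ via $x\mapsto(x,0)$. Standard basis: $e^{(0)}_0=1$; $e^{(k+1)}_j=(e^{(k)}_j,0)$ for $0\le j<2^k$ and $e^{(k+1)}_j=(0,e^{(k)}_{j-2^k})$ for $2^k\le j<2^{k+1}$. $\mathcal E_{n-1}'=\{e^{(n-1)}_1,\dots,e^{(n-1)}_{2^{n-1}-1}\}$, $\pm X=X\cup(-X)$. In $\mathcal A_n$, $\tilde e_0=(0,e_0)$ and $\tilde x=x\tilde e_0$, where $e_0$ denotes the unity. Elements $x,y$ are orthogonal if $xy=yx=0$. *)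

theory Defs
  imports Complex_Main
begin

text \<open>
  Elements of all the algebras live in one type of binary trees, since the level is a
  variable of the theorem.  The algebra of level \<open>k\<close> consists of the complete trees of depth
  \<open>k\<close> (\<open>cd_carrier k\<close>); the operations are unspecified on trees of unequal or wrong shape.
\<close>

datatype cd = Scal real | Pr cd cd

primrec cd_carrier :: "nat \<Rightarrow> cd set" where
  "cd_carrier 0 = range Scal"
| "cd_carrier (Suc k) = {Pr a b | a b. a \<in> cd_carrier k \<and> b \<in> cd_carrier k}"

instantiation cd :: "{plus, uminus, scaleR}"
begin

fun plus_cd :: "cd \<Rightarrow> cd \<Rightarrow> cd" where
  "Scal x + Scal y = Scal (x + y)"
| "Pr a b + Pr c d = Pr (a + c) (b + d)"

primrec uminus_cd :: "cd \<Rightarrow> cd" where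
  "- Scal x = Scal (- x)"
| "- Pr a b = Pr (- a) (- b)"

primrec scaleR_cd :: "real \<Rightarrow> cd \<Rightarrow> cd" where
  "r *\<^sub>R Scal x = Scal (r * x)"
| "r *\<^sub>R Pr a b = Pr (r *\<^sub>R a) (r *\<^sub>R b)"

instance ..

end

primrec cd_zero :: "nat \<Rightarrow> cd" where
  "cd_zero 0 = Scal 0"
| "cd_zero (Suc k) = Pr (cd_zero k) (cd_zero k)"

primrec cd_conj :: "cd \<Rightarrow> cd" where
  "cd_conj (Scal x) = Scal x"
| "cd_conj (Pr a b) = Pr (cd_conj a) (- b)"

text \<open>\<open>cd_mult \<gamma> k\<close> is the product of the algebra of level \<open>k\<close> with parameters
  \<open>\<gamma> 0, \<dots>, \<gamma> (k - 1)\<close>.\<close>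

fun cd_mult :: "(nat \<Rightarrow> real) \<Rightarrow> nat \<Rightarrow> cd \<Rightarrow> cd \<Rightarrow> cd" where
  "cd_mult \<gamma> 0 (Scal x) (Scal y) = Scal (x * y)"
| "cd_mult \<gamma> (Suc k) (Pr a b) (Pr c d) =
     Pr (cd_mult \<gamma> k a c + \<gamma> k *\<^sub>R cd_mult \<gamma> k (cd_conj d) b)
        (cd_mult \<gamma> k d a + cd_mult \<gamma> k b (cd_conj c))"

primrec cd_basis :: "nat \<Rightarrow> nat \<Rightarrow> cd" where
  "cd_basis 0 j = Scal 1"
| "cd_basis (Suc k) j =
     (if j < 2 ^ k then Pr (cd_basis k j) (cd_zero k)
      else Pr (cd_zero k) (cd_basis k (j - 2 ^ k)))"

definition cd_pm_imag_basis :: "nat \<Rightarrow> cd set" where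
  "cd_pm_imag_basis k = cd_basis k ` {1..<2 ^ k} \<union> uminus ` cd_basis k ` {1..<2 ^ k}"

text \<open>Linear independence of a finite family (so repetitions make it dependent).\<close>

definition cd_lin_indep :: "nat \<Rightarrow> cd list \<Rightarrow> bool" where
  "cd_lin_indep k xs \<longleftrightarrow>
     (\<forall>rs :: real list. length rs = length xs \<longrightarrow>
        foldr (+) (map2 (*\<^sub>R) rs xs) (cd_zero k) = cd_zero k \<longrightarrow> (\<forall>r \<in> set rs. r = 0))"

text \<open>The inclusion of level \<open>k\<close> into level \<open>k + 1\<close>.\<close>

definition cd_embed :: "nat \<Rightarrow> cd \<Rightarrow> cd" where
  "cd_embed k x = Pr x (cd_zero k)"

text \<open>For \<open>x\<close> of level \<open>k\<close>, the element \<open>x\<close> times \<open>(0, e\<^sub>0)\<close> of level \<open>k + 1\<close>;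
  \<open>cd_basis k 0\<close> is the unity \<open>e\<^sub>0\<close> (see \<open>cd_unity\<close> below).\<close>

definition cd_tilde :: "(nat \<Rightarrow> real) \<Rightarrow> nat \<Rightarrow> cd \<Rightarrow> cd" where
  "cd_tilde \<gamma> k x = cd_mult \<gamma> (Suc k) (cd_embed k x) (Pr (cd_zero k) (cd_basis k 0))"

definition cd_orthogonal :: "(nat \<Rightarrow> real) \<Rightarrow> nat \<Rightarrow> cd \<Rightarrow> cd \<Rightarrow> bool" where
  "cd_orthogonal \<gamma> k x y \<longleftrightarrow> cd_mult \<gamma> k x y = cd_zero k \<and> cd_mult \<gamma> k y x = cd_zero k"

text \<open>The algebras of level \<open>n \<ge> 1\<close> whose last parameter \<open>\<gamma> (n - 1)\<close> is replaced by
  \<open>\<gamma> n\<close> and by \<open>\<gamma> (n - 1) * \<gamma> n\<close>, respectively.\<close>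

definition circ_params :: "(nat \<Rightarrow> real) \<Rightarrow> nat \<Rightarrow> nat \<Rightarrow> real" where
  "circ_params \<gamma> n = \<gamma>(n - 1 := \<gamma> n)"

definition bullet_params :: "(nat \<Rightarrow> real) \<Rightarrow> nat \<Rightarrow> nat \<Rightarrow> real" where
  "bullet_params \<gamma> n = \<gamma>(n - 1 := \<gamma> (n - 1) * \<gamma> n)"

text \<open>The operations are well defined on each level.\<close>

lemma cd_zero_carrier: "cd_zero k \<in> cd_carrier k"
  by (induction k) auto

lemma cd_basis_carrier: "cd_basis k j \<in> cd_carrier k"
  by (induction k arbitrary: j) (auto simp: cd_zero_carrier)

lemma cd_uminus_carrier: "x \<in> cd_carrier k \<Longrightarrow> - x \<in> cd_carrier k"
  by (induction k arbitrary: x) auto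

lemma cd_scaleR_carrier: "x \<in> cd_carrier k \<Longrightarrow> r *\<^sub>R x \<in> cd_carrier k"
  by (induction k arbitrary: x) auto

lemma cd_plus_carrier: "x \<in> cd_carrier k \<Longrightarrow> y \<in> cd_carrier k \<Longrightarrow> x + y \<in> cd_carrier k"
  by (induction k arbitrary: x y) auto

lemma cd_conj_carrier: "x \<in> cd_carrier k \<Longrightarrow> cd_conj x \<in> cd_carrier k"
  by (induction k arbitrary: x) (auto simp: cd_uminus_carrier)

lemma cd_mult_carrier:
  "x \<in> cd_carrier k \<Longrightarrow> y \<in> cd_carrier k \<Longrightarrow> cd_mult \<gamma> k x y \<in> cd_carrier k"
  by (induction k arbitrary: x y)
     (auto simp: cd_plus_carrier cd_scaleR_carrier cd_conj_carrier)

lemma cd_plus_zero: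
  "x \<in> cd_carrier k \<Longrightarrow> x + cd_zero k = x \<and> cd_zero k + x = x"
  by (induction k arbitrary: x) auto

lemma cd_conj_zero: "- cd_zero k = cd_zero k" "cd_conj (cd_zero k) = cd_zero k"
  "r *\<^sub>R cd_zero k = cd_zero k"
proof -
  show "- cd_zero k = cd_zero k" by (induction k) auto
  then show "cd_conj (cd_zero k) = cd_zero k"
    by (induction k) auto
  show "r *\<^sub>R cd_zero k = cd_zero k" by (induction k) auto
qed

lemma cd_mult_zero:
  "x \<in> cd_carrier k \<Longrightarrow> cd_mult \<gamma> k x (cd_zero k) = cd_zero k \<and> cd_mult \<gamma> k (cd_zero k) x = cd_zero k"
  by (induction k arbitrary: x)
     (auto simp: cd_conj_zero cd_conj_carrier cd_plus_zero cd_zero_carrier cd_uminus_carrier)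

lemma cd_conj_unity: "cd_conj (cd_basis k 0) = cd_basis k 0"
  by (induction k) (auto simp: cd_conj_zero)

lemma cd_unity:
  "x \<in> cd_carrier k \<Longrightarrow> cd_mult \<gamma> k x (cd_basis k 0) = x \<and> cd_mult \<gamma> k (cd_basis k 0) x = x"
  by (induction k arbitrary: x)
     (auto simp: cd_conj_zero cd_conj_unity cd_mult_zero cd_conj_carrier cd_plus_zero)

end

theory Submission
  imports Defs
begin

text \<open>
  Two elements of \<open>\<plusminus>\<E>\<^sub>n\<^sub>-\<^sub>1'\<close> that are not equal up to sign anticommute.  For anticommuting
  imaginary entries, \<open>(x, y)\<close> and \<open>(z, w)\<close> are orthogonal iff \<open>x z = \<gamma> (w y)\<close> and \<open>w x = y z\<close>,
  where \<open>\<gamma>\<close> is the last parameter; this condition is unchanged when \<open>(x, y)\<close> is replaced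
  by \<open>(y, \<gamma> x)\<close>, because \<open>\<gamma>\<^sup>2 = 1\<close>.  Up to such swaps and a sign, only the pairs without
  a swap remain.  Writing \<open>t\<close> for the tilde, the products \<open>a c\<close>, \<open>a (t c)\<close>, \<open>(t a) c\<close>,
  \<open>(t a) (t c)\<close> in \<open>\<A>\<^sub>n\<close> are \<open>a c\<close>, \<open>- t (a c)\<close>, \<open>- t (a c)\<close>, \<open>\<gamma>\<^sub>n\<^sub>-\<^sub>1 (a c)\<close>, so the
  condition in \<open>\<A>\<^sub>n\<^sub>+\<^sub>1\<close> becomes the one in \<open>\<A>\<^sub>n\<^sup>\<circ>\<close> or \<open>\<A>\<^sub>n\<^sup>\<bullet>\<close>.
\<close>

section \<open>Linear structure on the trees of a fixed depth\<close>

lemma cd_minus_minus [simp]: "- (- x) = (x :: cd)"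
  by (induction x) auto

lemma cd_uminus_inject [simp]: "- x = - y \<longleftrightarrow> x = (y :: cd)"
  by (metis cd_minus_minus)

lemma cd_minus_eq_iff: "- x = y \<longleftrightarrow> x = - (y :: cd)"
  by (metis cd_minus_minus)

lemma cd_scaleR_one [simp]: "1 *\<^sub>R x = (x :: cd)"
  by (induction x) auto

lemma cd_scaleR_minus_one [simp]: "(-1) *\<^sub>R x = - (x :: cd)"
  by (induction x) auto

lemma cd_scaleR_scaleR: "r *\<^sub>R s *\<^sub>R x = (r * s) *\<^sub>R (x :: cd)"
  by (induction x) auto

lemma cd_scaleR_minus: "r *\<^sub>R (- x) = - (r *\<^sub>R (x :: cd))"
  by (induction x) auto

lemma cd_conj_scaleR: "cd_conj (r *\<^sub>R x) = r *\<^sub>R cd_conj x"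
  by (induction x) (auto simp: cd_scaleR_minus)

lemma cd_conj_minus: "cd_conj (- x) = - cd_conj x"
  by (induction x) auto

lemma cd_scaleR_zero:
  "x \<in> cd_carrier k \<Longrightarrow> 0 *\<^sub>R x = cd_zero k"
  by (induction k arbitrary: x) auto

lemma cd_scaleR_add:
  "x \<in> cd_carrier k \<Longrightarrow> y \<in> cd_carrier k \<Longrightarrow> r *\<^sub>R (x + y) = r *\<^sub>R x + r *\<^sub>R y"
  by (induction k arbitrary: x y) (auto simp: algebra_simps)

text \<open>The type is no group: each level has its own zero, and sums of trees of unequal shape
  are unspecified. Cancellation is therefore proved by induction on the level.\<close>

lemma cd_add_minus_eq_zero_iff:
  "x \<in> cd_carrier k \<Longrightarrow> y \<in> cd_carrier k \<Longrightarrow> x + - y = cd_zero k \<longleftrightarrow> x = y"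
  by (induction k arbitrary: x y) auto

lemma cd_minus_add_eq_zero_iff:
  "x \<in> cd_carrier k \<Longrightarrow> y \<in> cd_carrier k \<Longrightarrow> - x + y = cd_zero k \<longleftrightarrow> x = y"
  by (induction k arbitrary: x y) auto

text \<open>The two claims need a joint induction: the doubled product contains its factors in both
  orders, so scaling one pair scales left as well as right factors one level below.\<close>

lemma cd_mult_scaleR:
  assumes "x \<in> cd_carrier k" "y \<in> cd_carrier k"
  shows "cd_mult \<gamma> k (r *\<^sub>R x) y = r *\<^sub>R cd_mult \<gamma> k x y"
    and "cd_mult \<gamma> k x (r *\<^sub>R y) = r *\<^sub>R cd_mult \<gamma> k x y"
  using assms
proof (induction k arbitrary: x y)
  case (Suc k)
  note carr = cd_mult_carrier cd_conj_carrier cd_scaleR_carrier cd_uminus_carrier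
  {
    case 1
    then show ?case
      using Suc.IH
      by (auto simp: carr cd_scaleR_add[of _ k] cd_scaleR_scaleR mult.commute)
  next
    case 2
    then show ?case
      using Suc.IH
      by (auto simp: carr cd_scaleR_add[of _ k] cd_scaleR_scaleR mult.commute cd_conj_scaleR)
  }
qed auto

lemma cd_mult_minus:
  assumes "x \<in> cd_carrier k" "y \<in> cd_carrier k"
  shows "cd_mult \<gamma> k (- x) y = - cd_mult \<gamma> k x y"
    and "cd_mult \<gamma> k x (- y) = - cd_mult \<gamma> k x y"
  using cd_mult_scaleR[OF assms, of \<gamma> "-1"] by simp_all

text \<open>This lets the three algebras of level \<open>n\<close> share their level
  \<open>n - 1\<close>: changing the parameter of index \<open>n - 1\<close> affects only products
  of level \<open>n\<close> and above.\<close>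

lemma cd_mult_cong_params:
  assumes "\<And>i. i < k \<Longrightarrow> \<gamma> i = \<delta> i" "x \<in> cd_carrier k" "y \<in> cd_carrier k"
  shows "cd_mult \<gamma> k x y = cd_mult \<delta> k x y"
  using assms
proof (induction k arbitrary: x y)
  case (Suc k)
  have "cd_mult \<gamma> k u v = cd_mult \<delta> k u v" if "u \<in> cd_carrier k" "v \<in> cd_carrier k" for u v
    using Suc.IH[of u v] Suc.prems(1) that by simp
  then show ?case
    using Suc.prems by (auto simp: cd_conj_carrier)
qed auto

section \<open>Anticommuting imaginary elements\<close>

definition cd_imag :: "nat \<Rightarrow> cd set" where
  "cd_imag k = {x \<in> cd_carrier k. cd_conj x = - x}"

definition cd_anticomm :: "(nat \<Rightarrow> real) \<Rightarrow> nat \<Rightarrow> cd \<Rightarrow> cd \<Rightarrow> bool" where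
  "cd_anticomm \<gamma> k x y \<longleftrightarrow> cd_mult \<gamma> k y x = - cd_mult \<gamma> k x y"

lemma cd_imag_carrier: "x \<in> cd_imag k \<Longrightarrow> x \<in> cd_carrier k"
  by (simp add: cd_imag_def)

lemma cd_imag_conj: "x \<in> cd_imag k \<Longrightarrow> cd_conj x = - x"
  by (simp add: cd_imag_def)

lemma cd_imag_scaleR: "x \<in> cd_imag k \<Longrightarrow> r *\<^sub>R x \<in> cd_imag k"
  by (simp add: cd_imag_def cd_scaleR_carrier cd_conj_scaleR cd_scaleR_minus)

lemma cd_imag_minus: "x \<in> cd_imag k \<Longrightarrow> - x \<in> cd_imag k"
  by (simp add: cd_imag_def cd_uminus_carrier cd_conj_minus)

lemma cd_anticomm_sym: "cd_anticomm \<gamma> k x y \<Longrightarrow> cd_anticomm \<gamma> k y x"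
  by (simp add: cd_anticomm_def)

lemma cd_anticomm_scaleR:
  assumes "cd_anticomm \<gamma> k x y" "x \<in> cd_carrier k" "y \<in> cd_carrier k"
  shows "cd_anticomm \<gamma> k (r *\<^sub>R x) y" "cd_anticomm \<gamma> k x (r *\<^sub>R y)"
  using assms by (simp_all add: cd_anticomm_def cd_mult_scaleR cd_scaleR_minus)

lemma cd_basis_imag:
  assumes "1 \<le> j" "j < 2 ^ k"
  shows "cd_basis k j \<in> cd_imag k"
proof -
  have "cd_conj (cd_basis k j) = - cd_basis k j"
    using assms
    by (induction k arbitrary: j) (auto simp: cd_conj_zero)
  then show ?thesis
    by (simp add: cd_imag_def cd_basis_carrier)
qed

text \<open>Induction by halves of the index range. \<open>(e, 0)\<close> and \<open>(0, f)\<close>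
  have the products \<open>(0, f e)\<close> and \<open>(0, f (conj e))\<close>, which are opposite
  for imaginary \<open>e\<close>; two elements of the upper half reduce to
  \<open>conj e f = - conj f e\<close> one level below.\<close>

lemma cd_basis_anticomm:
  assumes "1 \<le> i" "i < 2 ^ k" "1 \<le> j" "j < 2 ^ k" "i \<noteq> j"
  shows "cd_anticomm \<gamma> k (cd_basis k i) (cd_basis k j)"
  using assms
proof (induction k arbitrary: i j)
  case (Suc k)
  note simps = cd_conj_zero cd_zero_carrier cd_basis_carrier cd_mult_carrier cd_conj_carrier
    cd_uminus_carrier cd_scaleR_carrier
  have mixed: "cd_anticomm \<gamma> (Suc k) (cd_basis (Suc k) i) (cd_basis (Suc k) j)"
    if "1 \<le> i" "i < 2 ^ k" "2 ^ k \<le> j" for i j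
    using that cd_imag_conj[OF cd_basis_imag[of i k]]
    by (simp add: cd_anticomm_def simps cd_mult_zero cd_plus_zero cd_mult_minus)
  consider "i < 2 ^ k" "j < 2 ^ k" | "i < 2 ^ k" "2 ^ k \<le> j" | "2 ^ k \<le> i" "j < 2 ^ k"
    | "2 ^ k \<le> i" "2 ^ k \<le> j"
    by linarith
  then show ?case
  proof cases
    case 1
    then have "cd_anticomm \<gamma> k (cd_basis k i) (cd_basis k j)"
      using Suc by blast
    then show ?thesis
      using 1 by (simp add: cd_anticomm_def simps cd_mult_zero cd_plus_zero)
  next
    case 2
    then show ?thesis using mixed Suc.prems by blast
  next
    case 3
    then show ?thesis using mixed Suc.prems cd_anticomm_sym by blast
  next
    case 4
    define i' j' where "i' = i - 2 ^ k" and "j' = j - 2 ^ k"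
    have bounds: "i' < 2 ^ k" "j' < 2 ^ k" "i' \<noteq> j'"
      using 4 Suc.prems by (auto simp: i'_def j'_def)
    let ?e = "cd_basis k i'" and ?f = "cd_basis k j'"
    have "cd_mult \<gamma> k (cd_conj ?e) ?f = - cd_mult \<gamma> k (cd_conj ?f) ?e"
    \<comment> \<open>Index 0 does occur, from \<open>i = 2 ^ k\<close> or \<open>j = 2 ^ k\<close>.
      The unity commutes with everything, and the sign comes from conjugating the other element,
      which is imaginary.\<close>
    proof (cases "i' = 0 \<or> j' = 0")
      case True
      then show ?thesis
        using bounds cd_imag_conj[OF cd_basis_imag[of i' k]] cd_imag_conj[OF cd_basis_imag[of j' k]]
        by (auto simp: cd_conj_unity cd_unity simps)
    next
      case False
      then have "cd_anticomm \<gamma> k ?e ?f"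
        using Suc.IH bounds by simp
      with False bounds show ?thesis
        by (simp add: cd_imag_conj[OF cd_basis_imag] cd_mult_minus cd_basis_carrier
            cd_anticomm_def)
    qed
    then show ?thesis
      using 4
      by (simp add: cd_anticomm_def simps cd_mult_zero cd_plus_zero cd_scaleR_minus
          flip: i'_def j'_def)
  qed
qed simp

section \<open>Signed basis elements and linear independence\<close>

lemma cd_pm_imag_basis_imag: "x \<in> cd_pm_imag_basis k \<Longrightarrow> x \<in> cd_imag k"
  by (auto simp: cd_pm_imag_basis_def intro!: cd_imag_minus cd_basis_imag)

lemma cd_pm_imag_basis_anticomm:
  assumes "x \<in> cd_pm_imag_basis k" "y \<in> cd_pm_imag_basis k" "x \<noteq> y" "x \<noteq> - y"
  shows "cd_anticomm \<gamma> k x y"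
proof -
  \<comment> \<open>The sign becomes a scalar, so that bilinearity treats all sign combinations at
    once.\<close>
  have unit: "\<exists>i r. 1 \<le> i \<and> i < 2 ^ k \<and> r \<in> {1, -1} \<and> z = r *\<^sub>R cd_basis k i"
    if z: "z \<in> cd_pm_imag_basis k" for z
  proof -
    obtain i where i: "1 \<le> i" "i < 2 ^ k" "z = cd_basis k i \<or> z = - cd_basis k i"
      using z unfolding cd_pm_imag_basis_def by auto
    then have "z = 1 *\<^sub>R cd_basis k i \<or> z = (-1) *\<^sub>R cd_basis k i"
      by simp
    with i show ?thesis
      by blast
  qed
  obtain i r where x: "1 \<le> i" "i < 2 ^ k" "r \<in> {1, -1}" "x = r *\<^sub>R cd_basis k i"
    using unit assms(1) by blast
  obtain j s where y: "1 \<le> j" "j < 2 ^ k" "s \<in> {1, -1}" "y = s *\<^sub>R cd_basis k j"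
    using unit assms(2) by blast
  have "i \<noteq> j"
    using x y assms(3,4) by auto
  then show ?thesis
    using x y cd_basis_anticomm
    by (simp add: cd_anticomm_scaleR cd_basis_carrier cd_scaleR_carrier del: insert_iff)
qed

text \<open>Supplies the hypotheses of \<open>cd_pm_imag_basis_anticomm\<close> for one element from
  each pair: an equation \<open>x = r y\<close> would be a linear dependence with coefficients 1 and
  \<open>- r\<close>.\<close>

lemma cd_lin_indep_not_parallel:
  assumes indep: "cd_lin_indep k [a, b, c, d]"
    and carr: "a \<in> cd_carrier k" "b \<in> cd_carrier k" "c \<in> cd_carrier k" "d \<in> cd_carrier k"
    and x: "x \<in> {a, b}" and y: "y \<in> {c, d}"
  shows "x \<noteq> y" "x \<noteq> - y"
proof -
  have "x \<noteq> r *\<^sub>R y" for r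
  proof
    assume eq: "x = r *\<^sub>R y"
    have coeffs: "p = 0 \<and> q = 0 \<and> s = 0 \<and> t = 0"
      if "p *\<^sub>R a + (q *\<^sub>R b + (s *\<^sub>R c + (t *\<^sub>R d + cd_zero k))) = cd_zero k" for p q s t
      using indep[unfolded cd_lin_indep_def, rule_format, of "[p, q, s, t]"] that by simp
    have cancel: "r *\<^sub>R z + (-r) *\<^sub>R z = cd_zero k" if "z \<in> cd_carrier k" for z
      using that by (induction k arbitrary: z) auto
    show False
      using x y eq coeffs[of 1 0 "-r" 0] coeffs[of 1 0 0 "-r"] coeffs[of 0 1 "-r" 0]
        coeffs[of 0 1 0 "-r"] carr
      by (auto simp: cd_scaleR_zero[of _ k] cd_plus_zero cd_scaleR_carrier cancel cd_zero_carrier)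
  qed
  from this[of 1] this[of "-1"] show "x \<noteq> y" "x \<noteq> - y"
    by simp_all
qed

section \<open>Orthogonality of pairs\<close>

text \<open>Anticommutation makes the product in one order the negative of the product in the other,
  so both vanish together; the two equations are the components of a single product.\<close>

lemma cd_orthogonal_Pr_iff:
  assumes imag: "x \<in> cd_imag k" "y \<in> cd_imag k" "z \<in> cd_imag k" "w \<in> cd_imag k"
    and anti: "cd_anticomm \<gamma> k x z" "cd_anticomm \<gamma> k x w"
      "cd_anticomm \<gamma> k y z" "cd_anticomm \<gamma> k y w"
  shows "cd_orthogonal \<gamma> (Suc k) (Pr x y) (Pr z w) \<longleftrightarrow>
    cd_mult \<gamma> k x z = \<gamma> k *\<^sub>R cd_mult \<gamma> k w y \<and> cd_mult \<gamma> k w x = cd_mult \<gamma> k y z"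
proof -
  note carr = imag[THEN cd_imag_carrier]
  have "cd_mult \<gamma> k z x = - cd_mult \<gamma> k x z" "cd_mult \<gamma> k y w = - cd_mult \<gamma> k w y"
    using anti by (auto simp: cd_anticomm_def)
  moreover have "cd_mult \<gamma> k x w = - cd_mult \<gamma> k w x" "cd_mult \<gamma> k z y = - cd_mult \<gamma> k y z"
    using anti by (auto simp: cd_anticomm_def)
  ultimately show ?thesis
    using carr
    by (auto simp: cd_orthogonal_def imag[THEN cd_imag_conj] cd_mult_minus cd_scaleR_minus
        cd_add_minus_eq_zero_iff cd_minus_add_eq_zero_iff cd_mult_carrier cd_scaleR_carrier
        cd_uminus_carrier)
qed

text \<open>The swap interchanges the two equations of \<open>cd_orthogonal_Pr_iff\<close>, up to
  the factor \<open>\<gamma> k\<close>, whose square is 1.\<close>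

lemma cd_orthogonal_Pr_swap:
  assumes imag: "x \<in> cd_imag k" "y \<in> cd_imag k" "z \<in> cd_imag k" "w \<in> cd_imag k"
    and anti: "cd_anticomm \<gamma> k x z" "cd_anticomm \<gamma> k x w"
      "cd_anticomm \<gamma> k y z" "cd_anticomm \<gamma> k y w"
    and unit: "\<gamma> k \<in> {1, -1}"
  shows "cd_orthogonal \<gamma> (Suc k) (Pr y (\<gamma> k *\<^sub>R x)) (Pr z w) \<longleftrightarrow>
    cd_orthogonal \<gamma> (Suc k) (Pr x y) (Pr z w)"
proof -
  note carr = imag[THEN cd_imag_carrier]
  have "cd_mult \<gamma> k w y = - cd_mult \<gamma> k y w" "cd_mult \<gamma> k w x = - cd_mult \<gamma> k x w"
    using anti by (auto simp: cd_anticomm_def)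
  moreover have "\<gamma> k * \<gamma> k = 1"
    using unit by auto
  moreover have "cd_orthogonal \<gamma> (Suc k) (Pr y (\<gamma> k *\<^sub>R x)) (Pr z w) \<longleftrightarrow>
      cd_mult \<gamma> k y z = \<gamma> k *\<^sub>R cd_mult \<gamma> k w (\<gamma> k *\<^sub>R x) \<and>
      cd_mult \<gamma> k w y = cd_mult \<gamma> k (\<gamma> k *\<^sub>R x) z"
    using imag carr anti
    by (intro cd_orthogonal_Pr_iff) (simp_all add: cd_imag_scaleR cd_anticomm_scaleR)
  ultimately show ?thesis
    using unit cd_orthogonal_Pr_iff[OF imag anti] carr
    by (auto simp: cd_mult_scaleR cd_scaleR_scaleR)
qed

lemma cd_orthogonal_commute: "cd_orthogonal \<gamma> k x y \<longleftrightarrow> cd_orthogonal \<gamma> k y x"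
  by (auto simp: cd_orthogonal_def)

text \<open>A swap in the second argument becomes one in the first by the symmetry of
  orthogonality.\<close>

lemma cd_orthogonal_Pr_swaps:
  assumes imag: "x \<in> cd_imag k" "y \<in> cd_imag k" "z \<in> cd_imag k" "w \<in> cd_imag k"
    and anti: "cd_anticomm \<gamma> k x z" "cd_anticomm \<gamma> k x w"
      "cd_anticomm \<gamma> k y z" "cd_anticomm \<gamma> k y w"
    and unit: "\<gamma> k \<in> {1, -1}"
    and u: "u \<in> {Pr x y, Pr y (\<gamma> k *\<^sub>R x)}" and v: "v \<in> {Pr z w, Pr w (\<gamma> k *\<^sub>R z)}"
  shows "cd_orthogonal \<gamma> (Suc k) u v \<longleftrightarrow> cd_orthogonal \<gamma> (Suc k) (Pr x y) (Pr z w)"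
proof -
  note carr = imag[THEN cd_imag_carrier]
  \<comment> \<open>The second pair stays arbitrary because \<open>v\<close> may be
    \<open>Pr z w\<close> or its swap.\<close>
  have left: "cd_orthogonal \<gamma> (Suc k) u (Pr z' w') \<longleftrightarrow> cd_orthogonal \<gamma> (Suc k) (Pr x y) (Pr z' w')"
    if "z' \<in> cd_imag k" "w' \<in> cd_imag k" "cd_anticomm \<gamma> k x z'" "cd_anticomm \<gamma> k x w'"
      "cd_anticomm \<gamma> k y z'" "cd_anticomm \<gamma> k y w'" for z' w'
    using u cd_orthogonal_Pr_swap[OF imag(1,2) that unit] by auto
  have "cd_orthogonal \<gamma> (Suc k) u v \<longleftrightarrow> cd_orthogonal \<gamma> (Suc k) (Pr x y) v"
    using v left[of z w] left[of w "\<gamma> k *\<^sub>R z"] imag carr anti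
    by (auto simp: cd_imag_scaleR cd_anticomm_scaleR)
  also have "\<dots> \<longleftrightarrow> cd_orthogonal \<gamma> (Suc k) v (Pr x y)"
    by (rule cd_orthogonal_commute)
  also have "\<dots> \<longleftrightarrow> cd_orthogonal \<gamma> (Suc k) (Pr z w) (Pr x y)"
    using v cd_orthogonal_Pr_swap[of z k w x y \<gamma>, OF imag(3,4,1,2) _ _ _ _ unit]
      anti[THEN cd_anticomm_sym] by auto
  finally show ?thesis
    by (simp add: cd_orthogonal_commute)
qed

text \<open>Needed for the second claim of the theorem, where one listed element is a swapped pair
  only up to the factor \<open>\<gamma> (n - 1)\<close>.\<close>

lemma cd_orthogonal_scaleR:
  assumes "x \<in> cd_carrier k" "y \<in> cd_carrier k" "r \<noteq> 0"
  shows "cd_orthogonal \<gamma> k (r *\<^sub>R x) y \<longleftrightarrow> cd_orthogonal \<gamma> k x y"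
    and "cd_orthogonal \<gamma> k x (r *\<^sub>R y) \<longleftrightarrow> cd_orthogonal \<gamma> k x y"
proof -
  have "r *\<^sub>R z = cd_zero k \<longleftrightarrow> z = cd_zero k" if "z \<in> cd_carrier k" for z
    using that assms(3) by (induction k arbitrary: z) auto
  then show "cd_orthogonal \<gamma> k (r *\<^sub>R x) y \<longleftrightarrow> cd_orthogonal \<gamma> k x y"
    "cd_orthogonal \<gamma> k x (r *\<^sub>R y) \<longleftrightarrow> cd_orthogonal \<gamma> k x y"
    using assms by (simp_all add: cd_orthogonal_def cd_mult_scaleR cd_mult_carrier)
qed

section \<open>Products of embedded and tilde elements\<close>

lemma cd_tilde_eq: "x \<in> cd_carrier k \<Longrightarrow> cd_tilde \<gamma> k x = Pr (cd_zero k) x"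
  by (simp add: cd_tilde_def cd_embed_def cd_conj_unity cd_conj_zero cd_mult_zero cd_unity
      cd_plus_zero cd_zero_carrier cd_basis_carrier)

lemma cd_embed_imag: "x \<in> cd_imag k \<Longrightarrow> cd_embed k x \<in> cd_imag (Suc k)"
  by (simp add: cd_imag_def cd_embed_def cd_conj_zero cd_zero_carrier)

lemma cd_tilde_imag: "x \<in> cd_imag k \<Longrightarrow> cd_tilde \<gamma> k x \<in> cd_imag (Suc k)"
  by (simp add: cd_imag_def cd_tilde_eq cd_conj_zero cd_zero_carrier)

text \<open>The minus sign in the second product comes from the reversed order in
  \<open>(x, 0) (0, y) = (0, y x)\<close>, in the third from \<open>conj y = - y\<close>; in the
  fourth both occur and cancel.\<close>

lemma cd_mult_embed_tilde:
  assumes "x \<in> cd_imag k" "y \<in> cd_imag k" "cd_anticomm \<gamma> k x y"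
  defines "xy \<equiv> cd_mult \<gamma> k x y"
  shows "cd_mult \<gamma> (Suc k) (cd_embed k x) (cd_embed k y) = cd_embed k xy"
    and "cd_mult \<gamma> (Suc k) (cd_embed k x) (cd_tilde \<gamma> k y) = - cd_tilde \<gamma> k xy"
    and "cd_mult \<gamma> (Suc k) (cd_tilde \<gamma> k x) (cd_embed k y) = - cd_tilde \<gamma> k xy"
    and "cd_mult \<gamma> (Suc k) (cd_tilde \<gamma> k x) (cd_tilde \<gamma> k y) = \<gamma> k *\<^sub>R cd_embed k xy"
proof -
  have carr: "x \<in> cd_carrier k" "y \<in> cd_carrier k"
    using assms(1,2) by (auto simp: cd_imag_carrier)
  have yx: "cd_mult \<gamma> k y x = - xy"
    using assms by (simp add: cd_anticomm_def)
  have xy: "xy \<in> cd_carrier k"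
    using carr by (simp add: xy_def cd_mult_carrier)
  note simps = cd_tilde_eq cd_embed_def cd_mult_zero cd_plus_zero cd_conj_zero cd_zero_carrier
    cd_mult_minus cd_scaleR_carrier cd_uminus_carrier cd_conj_carrier
  show "cd_mult \<gamma> (Suc k) (cd_embed k x) (cd_embed k y) = cd_embed k xy"
    using carr xy by (simp add: simps flip: xy_def)
  show "cd_mult \<gamma> (Suc k) (cd_embed k x) (cd_tilde \<gamma> k y) = - cd_tilde \<gamma> k xy"
    using carr xy by (simp add: simps yx)
  show "cd_mult \<gamma> (Suc k) (cd_tilde \<gamma> k x) (cd_embed k y) = - cd_tilde \<gamma> k xy"
    using carr xy assms(2) by (simp add: simps cd_imag_conj flip: xy_def)
  show "cd_mult \<gamma> (Suc k) (cd_tilde \<gamma> k x) (cd_tilde \<gamma> k y) = \<gamma> k *\<^sub>R cd_embed k xy"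
    using carr xy assms(2) by (simp add: simps cd_imag_conj yx)
qed

text \<open>The two mixed products have the same form, so exchanging the factors only replaces
  \<open>x y\<close> by \<open>y x = - x y\<close>.\<close>

lemma cd_anticomm_embed_tilde:
  assumes "x \<in> cd_imag k" "y \<in> cd_imag k" "cd_anticomm \<gamma> k x y"
  shows "cd_anticomm \<gamma> (Suc k) (cd_embed k x) (cd_embed k y)"
    and "cd_anticomm \<gamma> (Suc k) (cd_embed k x) (cd_tilde \<gamma> k y)"
    and "cd_anticomm \<gamma> (Suc k) (cd_tilde \<gamma> k x) (cd_embed k y)"
    and "cd_anticomm \<gamma> (Suc k) (cd_tilde \<gamma> k x) (cd_tilde \<gamma> k y)"
proof -
  have "cd_mult \<gamma> k y x = - cd_mult \<gamma> k x y"
    using assms(3) by (simp add: cd_anticomm_def)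
  moreover have "cd_embed k (- z) = - cd_embed k z" for z
    by (simp add: cd_embed_def cd_conj_zero)
  moreover have "cd_tilde \<gamma> k (- cd_mult \<gamma> k x y) = - cd_tilde \<gamma> k (cd_mult \<gamma> k x y)"
    using assms(1,2)
    by (simp add: cd_tilde_eq cd_conj_zero cd_uminus_carrier cd_mult_carrier cd_imag_carrier)
  ultimately show "cd_anticomm \<gamma> (Suc k) (cd_embed k x) (cd_embed k y)"
    "cd_anticomm \<gamma> (Suc k) (cd_embed k x) (cd_tilde \<gamma> k y)"
    "cd_anticomm \<gamma> (Suc k) (cd_tilde \<gamma> k x) (cd_embed k y)"
    "cd_anticomm \<gamma> (Suc k) (cd_tilde \<gamma> k x) (cd_tilde \<gamma> k y)"
    using cd_mult_embed_tilde[OF assms]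
      cd_mult_embed_tilde[OF assms(2,1) cd_anticomm_sym[OF assms(3)]]
    by (simp_all add: cd_anticomm_def cd_scaleR_minus)
qed

section \<open>Reduction of both equivalences to equations at level \<open>n - 1\<close>\<close>

theorem lemma6p14:
  fixes \<gamma> :: "nat \<Rightarrow> real" and n :: nat and a b c d :: cd
  assumes "\<And>k. \<gamma> k \<in> {1, -1}"
    and "n \<ge> 1"
    and "a \<in> cd_pm_imag_basis (n - 1)" "b \<in> cd_pm_imag_basis (n - 1)"
      "c \<in> cd_pm_imag_basis (n - 1)" "d \<in> cd_pm_imag_basis (n - 1)"
    and "cd_lin_indep (n - 1) [a, b, c, d]"
  defines "\<iota> \<equiv> cd_embed (n - 1)"
    and "t \<equiv> cd_tilde \<gamma> (n - 1)"
  shows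
    "(\<forall>x \<in> {Pr (\<iota> a) (\<iota> b), Pr (\<iota> b) (\<gamma> n *\<^sub>R \<iota> a), Pr (t a) (t b), Pr (t b) (\<gamma> n *\<^sub>R t a)}.
      \<forall>y \<in> {Pr (\<iota> c) (\<iota> d), Pr (\<iota> d) (\<gamma> n *\<^sub>R \<iota> c), Pr (t c) (t d), Pr (t d) (\<gamma> n *\<^sub>R t c)}.
        cd_orthogonal \<gamma> (n + 1) x y \<longleftrightarrow>
        cd_orthogonal (circ_params \<gamma> n) n (Pr a b) (Pr c d)) \<and>
     (\<forall>x \<in> {Pr (\<iota> a) (t b), Pr (t b) (\<gamma> n *\<^sub>R \<iota> a),
             Pr (t a) (\<gamma> (n - 1) *\<^sub>R \<iota> b), Pr (\<iota> b) ((\<gamma> (n - 1) * \<gamma> n) *\<^sub>R t a)}.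
      \<forall>y \<in> {Pr (\<iota> c) (t d), Pr (t d) (\<gamma> n *\<^sub>R \<iota> c),
             Pr (t c) (\<gamma> (n - 1) *\<^sub>R \<iota> d), Pr (\<iota> d) ((\<gamma> (n - 1) * \<gamma> n) *\<^sub>R t c)}.
        cd_orthogonal \<gamma> (n + 1) x y \<longleftrightarrow>
        cd_orthogonal (bullet_params \<gamma> n) n (Pr a b) (Pr c d))"
proof -
  obtain m where n: "n = Suc m"
    using assms(2) by (cases n) auto
  \<comment> \<open>With \<open>m = n - 1\<close>, these are the product of level
    \<open>n - 1\<close> and the parameters of index \<open>n - 1\<close> and
    \<open>n\<close>.\<close>
  define p g h where "p = cd_mult \<gamma> m" and "g = \<gamma> m" and "h = \<gamma> (Suc m)"
  have imag: "a \<in> cd_imag m" "b \<in> cd_imag m" "c \<in> cd_imag m" "d \<in> cd_imag m"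
    using assms(3-6) by (auto simp: n cd_pm_imag_basis_imag)
  note carr = imag[THEN cd_imag_carrier]
  \<comment> \<open>The parameters \<open>\<delta>\<close> are arbitrary, since this serves both
    \<open>\<gamma>\<close> and its modifications at index \<open>m\<close>.\<close>
  have anti: "cd_anticomm \<delta> m x y" if "x \<in> {a, b}" "y \<in> {c, d}" for x y \<delta>
  proof -
    have "x \<noteq> y" "x \<noteq> - y"
      using cd_lin_indep_not_parallel[OF _ carr that] assms(7) by (simp_all add: n)
    then show ?thesis
      using assms(3-6) that by (auto simp: n intro!: cd_pm_imag_basis_anticomm)
  qed
  \<comment> \<open>\<open>r = h\<close> gives the circ algebra and \<open>r = g * h\<close> the
    bullet algebra.\<close>
  have base: "cd_orthogonal (\<gamma>(m := r)) (Suc m) (Pr a b) (Pr c d) \<longleftrightarrow>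
      p a c = r *\<^sub>R p d b \<and> p d a = p b c" for r
  proof -
    have "cd_mult (\<gamma>(m := r)) m x y = p x y" if "x \<in> cd_carrier m" "y \<in> cd_carrier m" for x y
      unfolding p_def using that by (intro cd_mult_cong_params) auto
    then show ?thesis
      by (subst cd_orthogonal_Pr_iff) (use imag carr anti in auto)
  qed
  have \<iota>: "\<iota> = cd_embed m" and t: "t = cd_tilde \<gamma> m"
    by (simp_all add: \<iota>_def t_def n)
  have imag': "\<iota> x \<in> cd_imag (Suc m)" "t x \<in> cd_imag (Suc m)" if "x \<in> {a, b, c, d}" for x
    using that imag by (auto simp: \<iota> t cd_embed_imag cd_tilde_imag)
  have anti': "cd_anticomm \<gamma> (Suc m) (\<iota> x) (\<iota> y)" "cd_anticomm \<gamma> (Suc m) (\<iota> x) (t y)"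
      "cd_anticomm \<gamma> (Suc m) (t x) (\<iota> y)" "cd_anticomm \<gamma> (Suc m) (t x) (t y)"
    if "x \<in> {a, b}" "y \<in> {c, d}" for x y
    using that imag anti by (auto simp: \<iota> t intro!: cd_anticomm_embed_tilde)
  \<comment> \<open>Both orders are needed: in \<open>w y\<close> and \<open>w x\<close> the factor
    built from \<open>c\<close> or \<open>d\<close> comes first.\<close>
  have mult: "cd_mult \<gamma> (Suc m) (\<iota> x) (\<iota> y) = \<iota> (p x y)"
      "cd_mult \<gamma> (Suc m) (\<iota> x) (t y) = - t (p x y)"
      "cd_mult \<gamma> (Suc m) (t x) (\<iota> y) = - t (p x y)"
      "cd_mult \<gamma> (Suc m) (t x) (t y) = g *\<^sub>R \<iota> (p x y)"
    if "x \<in> {a, b} \<and> y \<in> {c, d} \<or> x \<in> {c, d} \<and> y \<in> {a, b}" for x y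
    using that imag anti anti[THEN cd_anticomm_sym]
    unfolding \<iota> t p_def g_def by (intro cd_mult_embed_tilde; auto)+
  have units: "g \<in> {1, -1}" "h \<in> {1, -1}"
    using assms(1) by (simp_all add: g_def h_def del: insert_iff)
  have p_carr: "p x y \<in> cd_carrier m" if "x \<in> cd_carrier m" "y \<in> cd_carrier m" for x y
    using that by (simp add: p_def cd_mult_carrier)
  have \<iota>_lin: "\<iota> u = \<iota> v \<longleftrightarrow> u = v" "- \<iota> u = \<iota> (- u)" "r *\<^sub>R \<iota> u = \<iota> (r *\<^sub>R u)" for u v r
    by (simp_all add: \<iota> cd_embed_def cd_conj_zero)
  have t_inj: "t u = t v \<longleftrightarrow> u = v" if "u \<in> cd_carrier m" "v \<in> cd_carrier m" for u v
    using that by (simp add: t cd_tilde_eq)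
  have t_lin: "- t u = t (- u)" "r *\<^sub>R t u = t (r *\<^sub>R u)" if "u \<in> cd_carrier m" for u r
    using that by (simp_all add: t cd_tilde_eq cd_conj_zero cd_uminus_carrier cd_scaleR_carrier)
  note [simp del] = cd_carrier.simps(2)
  let ?circ = "cd_orthogonal (circ_params \<gamma> n) n (Pr a b) (Pr c d)"
  let ?bullet = "cd_orthogonal (bullet_params \<gamma> n) n (Pr a b) (Pr c d)"
  let ?orth = "cd_orthogonal \<gamma> (Suc (Suc m))"
  have circ: "?circ \<longleftrightarrow> p a c = h *\<^sub>R p d b \<and> p d a = p b c"
    using base by (simp add: circ_params_def n h_def)
  have bullet: "?bullet \<longleftrightarrow> p a c = (g * h) *\<^sub>R p d b \<and> p d a = p b c"
    using base by (simp add: bullet_params_def n g_def h_def)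
  have core1: "?orth (Pr x y) (Pr z w) \<longleftrightarrow> ?circ"
    if "(x, y) \<in> {(\<iota> a, \<iota> b), (t a, t b)}" "(z, w) \<in> {(\<iota> c, \<iota> d), (t c, t d)}" for x y z w
  proof -
    have "?orth (Pr x y) (Pr z w) \<longleftrightarrow>
      cd_mult \<gamma> (Suc m) x z = h *\<^sub>R cd_mult \<gamma> (Suc m) w y \<and>
      cd_mult \<gamma> (Suc m) w x = cd_mult \<gamma> (Suc m) y z"
      unfolding h_def using that by (intro cd_orthogonal_Pr_iff) (auto simp: imag' anti')
    \<comment> \<open>In each of the four cases all products carry the same factor (1, -1 or
      \<open>g\<close>) and lie in the same half, so the factor cancels and \<open>h\<close>
      remains.\<close>
    also have "\<dots> \<longleftrightarrow> ?circ"
      using that units unfolding circ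
      by (elim insertE emptyE Pair_inject)
        (simp_all add: mult \<iota>_lin t_inj t_lin carr p_carr cd_uminus_carrier
         cd_scaleR_carrier cd_minus_eq_iff)
    finally show ?thesis .
  qed
  have core2: "?orth (Pr x y) (Pr z w) \<longleftrightarrow> ?bullet"
    if "(x, y) \<in> {(\<iota> a, t b), (t a, g *\<^sub>R \<iota> b)}" "(z, w) \<in> {(\<iota> c, t d), (t c, g *\<^sub>R \<iota> d)}" for x y z w
  proof -
    have "?orth (Pr x y) (Pr z w) \<longleftrightarrow>
      cd_mult \<gamma> (Suc m) x z = h *\<^sub>R cd_mult \<gamma> (Suc m) w y \<and>
      cd_mult \<gamma> (Suc m) w x = cd_mult \<gamma> (Suc m) y z"
      unfolding h_def using that
      by (intro cd_orthogonal_Pr_iff)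
        (auto simp: imag' anti' cd_imag_scaleR cd_anticomm_scaleR cd_imag_carrier)
    \<comment> \<open>In every case the factor of \<open>w y\<close> is \<open>g\<close> times that
      of \<open>x z\<close>, which turns \<open>h\<close> into \<open>g * h\<close>, while
      \<open>w x\<close> and \<open>y z\<close> have equal factors.\<close>
    also have "\<dots> \<longleftrightarrow> ?bullet"
      using that
      by (elim insertE emptyE Pair_inject; hypsubst;
          simp add: bullet mult cd_mult_scaleR imag' cd_imag_carrier cd_imag_scaleR;
          simp add: \<iota>_lin t_inj t_lin carr p_carr cd_uminus_carrier cd_scaleR_carrier
            cd_scaleR_minus cd_scaleR_scaleR;
          use units in \<open>auto simp: cd_minus_eq_iff\<close>)
    finally show ?thesis .
  qed
  show ?thesis
  proof (intro conjI ballI)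
    fix u v
    assume u: "u \<in> {Pr (\<iota> a) (\<iota> b), Pr (\<iota> b) (\<gamma> n *\<^sub>R \<iota> a), Pr (t a) (t b), Pr (t b) (\<gamma> n *\<^sub>R t a)}"
      and v: "v \<in> {Pr (\<iota> c) (\<iota> d), Pr (\<iota> d) (\<gamma> n *\<^sub>R \<iota> c), Pr (t c) (t d), Pr (t d) (\<gamma> n *\<^sub>R t c)}"
    \<comment> \<open>The listed elements are the two pairs treated by \<open>core1\<close> and
      their swaps.\<close>
    have "\<exists>(x, y) \<in> {(\<iota> a, \<iota> b), (t a, t b)}. u \<in> {Pr x y, Pr y (h *\<^sub>R x)}"
      using u by (auto simp: h_def n)
    then obtain x y where xy: "(x, y) \<in> {(\<iota> a, \<iota> b), (t a, t b)}"
      and u: "u \<in> {Pr x y, Pr y (h *\<^sub>R x)}"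
      by blast
    have "\<exists>(z, w) \<in> {(\<iota> c, \<iota> d), (t c, t d)}. v \<in> {Pr z w, Pr w (h *\<^sub>R z)}"
      using v by (auto simp: h_def n)
    then obtain z w where zw: "(z, w) \<in> {(\<iota> c, \<iota> d), (t c, t d)}"
      and v: "v \<in> {Pr z w, Pr w (h *\<^sub>R z)}"
      by blast
    have "?orth u v \<longleftrightarrow> ?orth (Pr x y) (Pr z w)"
      using xy zw units(2) u v unfolding h_def
      by (intro cd_orthogonal_Pr_swaps) (auto simp: imag' anti')
    then show "cd_orthogonal \<gamma> (n + 1) u v \<longleftrightarrow> ?circ"
      using core1[OF xy zw] by (simp add: n)
  next
    fix u v
    assume u: "u \<in> {Pr (\<iota> a) (t b), Pr (t b) (\<gamma> n *\<^sub>R \<iota> a),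
             Pr (t a) (\<gamma> (n - 1) *\<^sub>R \<iota> b), Pr (\<iota> b) ((\<gamma> (n - 1) * \<gamma> n) *\<^sub>R t a)}"
      and v: "v \<in> {Pr (\<iota> c) (t d), Pr (t d) (\<gamma> n *\<^sub>R \<iota> c),
             Pr (t c) (\<gamma> (n - 1) *\<^sub>R \<iota> d), Pr (\<iota> d) ((\<gamma> (n - 1) * \<gamma> n) *\<^sub>R t c)}"
    have gg: "g * g = 1" and g_nz: "g \<noteq> 0"
      using units by auto
    \<comment> \<open>The scalar \<open>g\<close> is needed only for the last element of the list:
      the swap of \<open>(t a, g \<iota> b)\<close> is \<open>(g \<iota> b, h t a)\<close>, and
      \<open>g\<close> times it is \<open>(\<iota> b, g h t a)\<close> because
      \<open>g * g = 1\<close>.\<close>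
    have "\<exists>(x, y) \<in> {(\<iota> a, t b), (t a, g *\<^sub>R \<iota> b)}. \<exists>u' \<in> {Pr x y, Pr y (h *\<^sub>R x)}.
        u = u' \<or> u = g *\<^sub>R u'"
      using u gg by (auto simp: cd_scaleR_scaleR simp flip: g_def h_def simp: n)
    then obtain x y u' where xy: "(x, y) \<in> {(\<iota> a, t b), (t a, g *\<^sub>R \<iota> b)}"
      and u': "u' \<in> {Pr x y, Pr y (h *\<^sub>R x)}" and u: "u = u' \<or> u = g *\<^sub>R u'"
      by blast
    have "\<exists>(z, w) \<in> {(\<iota> c, t d), (t c, g *\<^sub>R \<iota> d)}. \<exists>v' \<in> {Pr z w, Pr w (h *\<^sub>R z)}.
        v = v' \<or> v = g *\<^sub>R v'"
      using v gg by (auto simp: cd_scaleR_scaleR simp flip: g_def h_def simp: n)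
    then obtain z w v' where zw: "(z, w) \<in> {(\<iota> c, t d), (t c, g *\<^sub>R \<iota> d)}"
      and v': "v' \<in> {Pr z w, Pr w (h *\<^sub>R z)}" and v: "v = v' \<or> v = g *\<^sub>R v'"
      by blast
    have imag_xyzw: "x \<in> cd_imag (Suc m)" "y \<in> cd_imag (Suc m)"
      "z \<in> cd_imag (Suc m)" "w \<in> cd_imag (Suc m)"
      using xy zw by (auto simp: imag' cd_imag_scaleR)
    then have "u' \<in> cd_carrier (Suc (Suc m))" "v' \<in> cd_carrier (Suc (Suc m))"
      using u' v' by (auto simp: cd_carrier.simps(2)[of "Suc m"] cd_imag_carrier cd_scaleR_carrier)
    then have "?orth u v \<longleftrightarrow> ?orth u' v'"
      using u v g_nz by (auto simp: cd_orthogonal_scaleR cd_scaleR_carrier)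
    also have "\<dots> \<longleftrightarrow> ?orth (Pr x y) (Pr z w)"
      using xy zw units(2) u' v' imag_xyzw unfolding h_def
      by (intro cd_orthogonal_Pr_swaps)
        (auto simp: imag' anti' cd_imag_scaleR cd_anticomm_scaleR cd_imag_carrier)
    finally show "cd_orthogonal \<gamma> (n + 1) u v \<longleftrightarrow> ?bullet"
      using core2[OF xy zw] by (simp add: n)
  qed
qed

end
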